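(* Let $n\ge 1$ and let $P,Q\in\mathcal{H}_n$ be such that $Q\preccurlyeq P$. Then for every $\lambda\in\mathbb{R}$ one has $Q-\lambda Q'\preccurlyeq P-\lambda P'$.
   Context: $\mathcal{H}_n$ denotes the set of monic univariate polynomials of degree $n$ all of whose zeros are real (hyperbolic polynomials). For $P\in\mathcal{H}_n$, $\mathcal{Z}(P)$ is the unordered $n$-tuple of zeros of $P$ counted with multiplicity. Spectral order (classical majorization): for unordered real $n$-tuples $X=(x_1,\dots,x_n)$, $Y=(y_1,\dots,y_n)$ write $X\prec Y$ if $\sum_{i=1}^n f(x_i)\le\sum_{i=1}^n f(y_i)$ for every convex $f:\mathbb{R}\to\mathbb{R}$ (equivalently, $X=AY$ as column vectors for some doubly stochastic matrix $A$). For $P,Q\in\mathcal{H}_n$ write $Q\preccurlyeq P$ if $\mathcal{Z}(Q)\prec\mathcal{Z}(P)$; this is a partial order on $\mathcal{H}_n$. (For $P\in\mathcal{H}_n$ and $\lambda\in\mathbb{R}$ one has $P-\lambda P'\in\mathcal{H}_n$ by the Hermite-Poulain theorem.) *)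

theory Defs
  imports "HOL-Analysis.Analysis" "HOL-Computational_Algebra.Computational_Algebra"
begin

(* The zeros are taken in the complex numbers. Coefficients are real without loss of
   generality: a monic complex polynomial with only real zeros has real coefficients. *)
definition hyperbolic_polys :: "nat \<Rightarrow> real poly set" where
  "hyperbolic_polys n =
     {p. lead_coeff p = 1 \<and> degree p = n \<and>
         (\<forall>z. poly (map_poly complex_of_real p) z = 0 \<longrightarrow> z \<in> \<real>)}"

(* Unordered n-tuples are multisets of size n. *)
definition majorized :: "real multiset \<Rightarrow> real multiset \<Rightarrow> bool"
  (infix "\<prec>\<^sub>m" 50) where
  "X \<prec>\<^sub>m Y \<longleftrightarrow> size X = size Y \<and>
     (\<forall>f :: real \<Rightarrow> real. convex_on UNIV f \<longrightarrow> (\<Sum>x\<in>#X. f x) \<le> (\<Sum>y\<in>#Y. f y))"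

(* A relation on hyperbolic polynomials of degree n, so it includes membership of both
   sides. The multiset proots p collects the real zeros of p with multiplicity; for
   hyperbolic p these are all the zeros. *)
definition spectral_le :: "nat \<Rightarrow> real poly \<Rightarrow> real poly \<Rightarrow> bool" where
  "spectral_le n q p \<longleftrightarrow>
     q \<in> hyperbolic_polys n \<and> p \<in> hyperbolic_polys n \<and> proots q \<prec>\<^sub>m proots p"

end

theory Submission
  imports Defs
begin

text \<open>
  Write \<open>T p = p - c p'\<close>. Majorization is generated by pinches, which replace two zeros
  \<open>a, b + s\<close> by \<open>a + s, b\<close>, where \<open>a < b\<close> and \<open>s > 0\<close>, so it suffices to treat one pinch, and by perturbation the
  other zeros, collected in a polynomial \<open>R\<close>, may be assumed simple and distinct from \<open>a, b\<close>.
  With \<open>M = T ((x - a) (x - b) R)\<close>, \<open>U = T ((x - a) R)\<close> and \<open>V = T ((x - b) R)\<close>, the images of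
  the two polynomials under \<open>T\<close> are \<open>M - s U\<close> and \<open>M - s V\<close>. Both \<open>U\<close> and \<open>V\<close> interlace \<open>M\<close>, and
  the zeros of \<open>U\<close> lie below those of \<open>V\<close>. Move the zeros of \<open>U\<close> to those of \<open>V\<close> one at a
  time. When the \<open>j\<close>-th one is raised, signs show that the zeros of \<open>M - s U\<close> with index at most
  \<open>j\<close> move up and the others move down, all of them towards the \<open>(j+1)\<close>-st zero of \<open>M\<close>, while their
  sum stays the same. Hence sums of a convex function over the zeros decrease.
\<close>

section \<open>Monic polynomials with real zeros\<close>

text \<open>Zeros are kept as a family indexed below \<open>n\<close>, not as a multiset, so that
  single zeros can be followed while they move.\<close>

definition roots_poly :: "nat \<Rightarrow> (nat \<Rightarrow> real) \<Rightarrow> real poly" where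
  "roots_poly n y = (\<Prod>i<n. [:- y i, 1:])"

definition hp_op :: "real \<Rightarrow> real poly \<Rightarrow> real poly" where
  "hp_op c p = p - smult c (pderiv p)"

text \<open>Each \<open>w i\<close> has its own bracket with ends taken from \<open>m\<close> alone,
  so coordinates of \<open>w\<close> can be exchanged one at a time.\<close>

definition interlaces :: "nat \<Rightarrow> (nat \<Rightarrow> real) \<Rightarrow> (nat \<Rightarrow> real) \<Rightarrow> bool" where
  "interlaces n m w \<longleftrightarrow> (\<forall>i<n. m i < w i \<and> w i < m (Suc i))"

lemma poly_roots_poly: "poly (roots_poly n y) x = (\<Prod>i<n. x - y i)"
  by (simp add: roots_poly_def poly_prod)

lemma roots_poly_Suc: "roots_poly (Suc n) y = [:- y n, 1:] * roots_poly n y"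
  by (simp add: roots_poly_def mult.commute)

lemma roots_poly_cong: "(\<And>i. i < n \<Longrightarrow> y i = z i) \<Longrightarrow> roots_poly n y = roots_poly n z"
  by (simp add: roots_poly_def)

lemma degree_roots_poly [simp]: "degree (roots_poly n y) = n"
  unfolding roots_poly_def by (subst degree_prod_eq_sum_degree) auto

lemma lead_coeff_roots_poly: "lead_coeff (roots_poly n y) = 1"
  unfolding roots_poly_def lead_coeff_prod by simp

lemma coeff_roots_poly [simp]: "coeff (roots_poly n y) n = 1"
  using lead_coeff_roots_poly[of n y] by simp

lemma roots_poly_nonzero [simp]: "roots_poly n y \<noteq> 0"
  using coeff_roots_poly[of n y] by fastforce

lemma poly_roots_poly_eq_0_iff: "poly (roots_poly n y) x = 0 \<longleftrightarrow> x \<in> y ` {..<n}"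
  by (auto simp: poly_roots_poly)

lemma proots_roots_poly: "proots (roots_poly n y) = image_mset y (mset_set {..<n})"
proof (induction n)
  case (Suc n)
  have "proots (roots_poly (Suc n) y) = proots [:- y n, 1:] + proots (roots_poly n y)"
    unfolding roots_poly_Suc by (intro proots_mult) auto
  then show ?case
    using Suc by (simp add: lessThan_Suc)
qed (simp add: roots_poly_def)

lemma coeff_roots_poly_sum: "coeff (roots_poly (Suc n) y) n = - (\<Sum>i\<le>n. y i)"
proof (induction n)
  case (Suc n)
  have "coeff (roots_poly (Suc (Suc n)) y) (Suc n)
      = - y (Suc n) * coeff (roots_poly (Suc n) y) (Suc n) + coeff (roots_poly (Suc n) y) n"
    by (subst roots_poly_Suc) simp
  then show ?case
    using Suc by simp
qed (simp add: roots_poly_def)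

section \<open>The operator p - c p'\<close>

lemma degree_hp_op [simp]: "degree (hp_op c p) = degree p"
proof (cases "degree p = 0")
  case True
  then obtain a where "p = [:a:]"
    by (metis degree_eq_zeroE)
  then show ?thesis
    by (simp add: hp_op_def)
next
  case False
  have "degree (smult c (pderiv p)) < degree p"
    using False by (metis degree_pderiv degree_smult_le diff_less le_neq_implies_less less_imp_diff_less
        less_le_trans nat_neq_iff not_less not_gr0 zero_less_one)
  then show ?thesis
    unfolding hp_op_def by (metis degree_add_eq_left degree_minus uminus_add_conv_diff add.commute)
qed

lemma coeff_hp_op: "coeff (hp_op c p) k = coeff p k - c * (of_nat (Suc k) * coeff p (Suc k))"
  by (simp add: hp_op_def coeff_pderiv)

lemma lead_coeff_hp_op [simp]: "lead_coeff (hp_op c p) = lead_coeff p"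
  by (simp add: coeff_hp_op coeff_eq_0)

lemma hp_op_diff: "hp_op c (p - q) = hp_op c p - hp_op c q"
  by (simp add: hp_op_def pderiv_diff smult_diff_right)

lemma hp_op_smult: "hp_op c (smult a p) = smult a (hp_op c p)"
  by (simp add: hp_op_def pderiv_smult smult_diff_right mult.commute)

text \<open>The product rule. At a zero of T p the right-hand side is \<open>- c * poly p x\<close>,
  whatever \<open>e\<close> is, so all polynomials T ((x - e) p) have the same sign there.\<close>

lemma poly_hp_op_linear_mult:
  "poly (hp_op c ([:-e, 1:] * p)) x = (x - e) * poly (hp_op c p) x - c * poly p x"
  unfolding hp_op_def pderiv_mult by (simp add: pderiv_pCons algebra_simps)

section \<open>Signs by counting larger zeros, and zeros located by sign changes\<close>

lemma prod_diff_sign: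
  fixes x :: real
  assumes "finite I" "\<And>l. l \<in> I \<Longrightarrow> x \<noteq> r l"
  shows "0 < (-1) ^ card {l\<in>I. x < r l} * (\<Prod>l\<in>I. x - r l)"
  using assms
proof (induction I rule: finite_induct)
  case (insert a I)
  have IH: "0 < (-1) ^ card {l\<in>I. x < r l} * (\<Prod>l\<in>I. x - r l)"
    using insert by auto
  show ?case
  proof (cases "x < r a")
    case True
    then have "{l\<in>insert a I. x < r l} = insert a {l\<in>I. x < r l}"
      by auto
    then have "card {l\<in>insert a I. x < r l} = Suc (card {l\<in>I. x < r l})"
      using insert by simp
    moreover have "0 < (r a - x) * ((-1) ^ card {l\<in>I. x < r l} * (\<Prod>l\<in>I. x - r l))"
      using True by (intro mult_pos_pos IH) simp
    ultimately show ?thesis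
      using insert by (simp add: algebra_simps)
  next
    case False
    then have "{l\<in>insert a I. x < r l} = {l\<in>I. x < r l}"
      by auto
    moreover have "0 < (x - r a) * ((-1) ^ card {l\<in>I. x < r l} * (\<Prod>l\<in>I. x - r l))"
      using False insert.prems[of a] by (intro mult_pos_pos IH) auto
    ultimately show ?thesis
      using insert by (simp add: algebra_simps)
  qed
qed simp

text \<open>The \<open>n - j\<close> factors with index at least \<open>j\<close> are negative. The
  exponent \<open>n + j\<close> has the same parity as \<open>n - j\<close> and avoids truncated
  subtraction.\<close>

lemma roots_poly_sign:
  assumes "j \<le> n" "\<And>l. l < j \<Longrightarrow> r l < x" "\<And>l. j \<le> l \<Longrightarrow> l < n \<Longrightarrow> x < r l"
  shows "0 < (-1) ^ (n + j) * poly (roots_poly n r) x"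
proof -
  have "{l\<in>{..<n}. x < r l} = {j..<n}"
    using assms by (auto simp: not_less) (meson assms(2) leI less_asym)
  moreover have "x \<noteq> r l" if "l < n" for l
    using assms(2)[of l] assms(3)[of l] that by fastforce
  ultimately have "0 < (-1) ^ (n - j) * poly (roots_poly n r) x"
    using prod_diff_sign[of "{..<n}" x r] by (simp add: poly_roots_poly)
  moreover have "(-1::real) ^ (n + j) = (-1) ^ (n - j)"
    using assms(1) by (simp add: uminus_power_if)
  ultimately show ?thesis
    by simp
qed

lemma opposite_signs:
  fixes a b :: real
  assumes "0 < (-1) ^ k * a" "0 < (-1) ^ Suc k * b"
  shows "a * b < 0"
  using assms by (cases "even k") (auto simp: mult_less_0_iff)

lemma adjacent_less:
  fixes y :: "nat \<Rightarrow> real"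
  assumes "\<And>i. Suc i < n \<Longrightarrow> y i < y (Suc i)" "i < j" "j < n"
  shows "y i < y j"
  using assms(2,3)
proof (induction j)
  case (Suc j)
  then show ?case
    using assms(1)[of j] by (cases "i = j") auto
qed simp

text \<open>A nonzero difference of the two monic polynomials would have degree below
  \<open>n\<close> and \<open>n\<close> distinct zeros.\<close>

lemma roots_poly_unique:
  assumes "degree p = n" "lead_coeff p = 1" "inj_on y {..<n}" "\<And>i. i < n \<Longrightarrow> poly p (y i) = 0"
  shows "p = roots_poly n y"
proof (rule ccontr)
  assume ne: "p \<noteq> roots_poly n y"
  define q where "q = p - roots_poly n y"
  have "q \<noteq> 0"
    using ne by (simp add: q_def)
  have "coeff q n = 0"
    using assms by (simp add: q_def)
  moreover have "degree q \<le> n"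
    using assms by (simp add: q_def degree_diff_le)
  ultimately have "degree q < n"
    using \<open>q \<noteq> 0\<close> by (metis eq_zero_or_degree_less)
  moreover have "y ` {..<n} \<subseteq> {x. poly q x = 0}"
    using assms(4) by (auto simp: q_def poly_roots_poly_eq_0_iff)
  then have "card (y ` {..<n}) \<le> card {x. poly q x = 0}"
    using \<open>q \<noteq> 0\<close> by (intro card_mono poly_roots_finite)
  ultimately show False
    using \<open>q \<noteq> 0\<close> card_poly_roots_bound[of q] assms(3) by (simp add: card_image)
qed

text \<open>Each sign change gives a zero by the intermediate value theorem; the brackets do not
  overlap, so these are \<open>n\<close> distinct zeros, which is all the degree allows.\<close>

lemma roots_in_brackets:
  assumes "degree p = n" "lead_coeff p = 1"
    and "\<And>i. i < n \<Longrightarrow> lo i < hi i"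
    and "\<And>i. i < n \<Longrightarrow> poly p (lo i) * poly p (hi i) < 0"
    and "\<And>i. Suc i < n \<Longrightarrow> hi i \<le> lo (Suc i)"
  obtains y where "p = roots_poly n y" "\<And>i. i < n \<Longrightarrow> lo i < y i" "\<And>i. i < n \<Longrightarrow> y i < hi i"
proof -
  have "\<exists>x. lo i < x \<and> x < hi i \<and> poly p x = 0" if "i < n" for i
    using poly_IVT[of "lo i" "hi i" p] assms(3,4)[OF that] by blast
  then obtain y where y: "\<And>i. i < n \<Longrightarrow> lo i < y i \<and> y i < hi i \<and> poly p (y i) = 0"
    by metis
  have "y i < y (Suc i)" if "Suc i < n" for i
    using y[of i] y[of "Suc i"] assms(5)[of i] that by auto
  then have "y i < y j" if "i < j" "j < n" for i j
    using adjacent_less that by blast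
  then have "inj_on y {..<n}"
    by (intro linorder_inj_onI) fastforce+
  then show thesis
    using that[of y] y roots_poly_unique[OF assms(1,2)] by blast
qed

lemma monic_eventually_pos:
  fixes p :: "real poly"
  assumes "lead_coeff p = 1"
  shows "\<exists>K. \<forall>x\<ge>K. 0 < poly p x"
  using poly_pinfty_gt_lc[of p] assms by (metis less_le_trans zero_less_one)

lemma monic_ends:
  fixes p :: "real poly"
  assumes "lead_coeff p = 1"
  obtains K where "B < K" "0 < poly p K" "0 < (-1) ^ degree p * poly p (- K)"
proof -
  \<comment> \<open>The reflected polynomial is again monic, so its positivity near infinity gives
    the sign of \<open>p\<close> near minus infinity.\<close>
  define q where "q = smult ((-1) ^ degree p) (pcompose p [:0, -1:])"
  have "lead_coeff q = 1"
    using assms by (simp add: q_def lead_coeff_comp flip: power_mult_distrib)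
  from monic_eventually_pos[OF this] obtain K1 where K1: "\<And>x. x \<ge> K1 \<Longrightarrow> 0 < poly q x"
    by blast
  from monic_eventually_pos[OF assms] obtain K2 where K2: "\<And>x. x \<ge> K2 \<Longrightarrow> 0 < poly p x"
    by blast
  define K where "K = max (B + 1) (max K1 K2)"
  have "B < K" "0 < poly p K" "0 < poly q K"
    using K1 K2 by (auto simp: K_def)
  then show thesis
    using that[of K] by (simp add: q_def poly_pcompose)
qed

lemma roots_between_alternations:
  assumes "degree p = n" "lead_coeff p = 1"
    and "\<And>i. i < n \<Longrightarrow> g i < g (Suc i)"
    and "\<And>i. i \<le> n \<Longrightarrow> 0 < (-1) ^ (n + i) * poly p (g i)"
  obtains y where "p = roots_poly n y" "\<And>i. i < n \<Longrightarrow> g i < y i" "\<And>i. i < n \<Longrightarrow> y i < g (Suc i)"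
proof (rule roots_in_brackets[OF assms(1,2), of g "\<lambda>i. g (Suc i)"])
  show "poly p (g i) * poly p (g (Suc i)) < 0" if "i < n" for i
    using assms(4)[of i] assms(4)[of "Suc i"] that by (intro opposite_signs[of "n + i"]) auto
qed (use assms(3) that in auto)

section \<open>Interlacing\<close>

text \<open>A finite set has one strictly increasing listing. This identifies families of zeros that
  come from separate existence statements about one polynomial.\<close>

lemma strictly_sorted_unique:
  fixes m m' :: "nat \<Rightarrow> real"
  assumes "roots_poly n m = roots_poly n m'"
    and "\<And>i. Suc i < n \<Longrightarrow> m i < m (Suc i)" "\<And>i. Suc i < n \<Longrightarrow> m' i < m' (Suc i)"
    and "i < n"
  shows "m i = m' i"
proof -
  have "m ` {..<n} = m' ` {..<n}"
    unfolding set_eq_iff using assms(1) by (metis poly_roots_poly_eq_0_iff)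
  moreover have "sorted_wrt (<) (map m [0..<n])" "sorted_wrt (<) (map m' [0..<n])"
    using adjacent_less[of n m, OF assms(2)] adjacent_less[of n m', OF assms(3)]
    by (auto simp: sorted_wrt_iff_nth_less)
  ultimately have "map m [0..<n] = map m' [0..<n]"
    by (intro strict_sorted_equal) (auto simp: atLeast0LessThan)
  then show ?thesis
    using assms(4) by simp
qed

text \<open>The derivative at a zero is the product of its differences with the other zeros, of
  which the \<open>n - i - 1\<close> larger ones contribute negative factors.\<close>

lemma pderiv_sign_at_root:
  assumes "\<And>i. Suc i < n \<Longrightarrow> r i < r (Suc i)" "i < n"
  shows "0 < (-1) ^ (n + i + 1) * poly (pderiv (roots_poly n r)) (r i)"
proof -
  define q where "q = (\<Prod>l\<in>{..<n} - {i}. [:- r l, 1:])"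
  have "roots_poly n r = [:- r i, 1:] * q"
    unfolding roots_poly_def q_def using assms(2) by (intro prod.remove) auto
  then have "poly (pderiv (roots_poly n r)) (r i) = poly q (r i)"
    by (simp only: pderiv_mult poly_add poly_mult) (simp add: pderiv_pCons)
  also have "\<dots> = (\<Prod>l\<in>{..<n} - {i}. r i - r l)"
    by (simp add: q_def poly_prod)
  finally have eq: "poly (pderiv (roots_poly n r)) (r i) = (\<Prod>l\<in>{..<n} - {i}. r i - r l)" .
  have less: "r l < r k" if "l < k" "k < n" for l k
    using adjacent_less[of n r] assms(1) that by blast
  have "{l\<in>{..<n} - {i}. r i < r l} = {Suc i..<n}"
    using less assms(2) by (auto simp: Suc_le_eq) (metis less_asym linorder_neqE_nat)
  moreover have "r i \<noteq> r l" if "l \<in> {..<n} - {i}" for l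
    using less[of l i] less[of i l] that assms(2) by (cases "l < i") auto
  ultimately have "0 < (-1) ^ (n - Suc i) * poly (pderiv (roots_poly n r)) (r i)"
    using prod_diff_sign[of "{..<n} - {i}" "r i" r] unfolding eq by simp
  moreover have "(-1::real) ^ (n + i + 1) = (-1) ^ (n - Suc i)"
    using assms(2) by (simp add: uminus_power_if)
  ultimately show ?thesis
    by simp
qed

text \<open>At a zero of p the value of T p is \<open>- c\<close> times the derivative, so T p
  alternates along the zeros of p; one more sign change comes from infinity, on the side given by
  the sign of \<open>c\<close>. The last conclusion gives the signs of c p at the zeros of T p,
  needed for T ((x - e) p).\<close>

lemma hp_op_simple_roots:
  assumes "c \<noteq> 0" and sorted: "\<And>i. Suc i < n \<Longrightarrow> r i < r (Suc i)"
  obtains t where "hp_op c (roots_poly n r) = roots_poly n t"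
    and "\<And>i. Suc i < n \<Longrightarrow> t i < t (Suc i)"
    and "\<And>i. i < n \<Longrightarrow> 0 < (-1) ^ (n + i + 1) * (c * poly (roots_poly n r) (t i))"
proof -
  let ?p = "hp_op c (roots_poly n r)"
  have deg: "degree ?p = n" and lead: "lead_coeff ?p = 1"
    by (simp, simp only: lead_coeff_hp_op lead_coeff_roots_poly)
  have less: "r l < r k" if "l < k" "k < n" for l k
    using adjacent_less[of n r] sorted that by blast
  have at_root: "poly ?p (r i) = - c * poly (pderiv (roots_poly n r)) (r i)" if "i < n" for i
    using that by (simp add: hp_op_def poly_roots_poly_eq_0_iff)
  obtain K where K: "Max (insert 0 ((\<lambda>i. \<bar>r i\<bar>) ` {..<n})) < K" "0 < poly ?p K" "0 < (-1) ^ n * poly ?p (- K)"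
    using monic_ends[OF lead] unfolding deg by blast
  have K_bound: "\<bar>r i\<bar> < K" if "i < n" for i
    using K(1) that by simp
  show thesis
  proof (cases "c > 0")
    case True
    \<comment> \<open>For positive \<open>c\<close>, T p is negative at the largest zero of p and
      positive far to the right, so the extra sample point \<open>K\<close> comes last.\<close>
    define g where "g = (\<lambda>i. if i < n then r i else K)"
    have g: "g i < g (Suc i)" if "i < n" for i
      using sorted[of i] K_bound[of i] that by (auto simp: g_def)
    have "0 < (-1) ^ (n + i) * poly ?p (g i)" if "i \<le> n" for i
    proof (cases "i < n")
      case i: True
      have "0 < c * ((-1) ^ (n + i + 1) * poly (pderiv (roots_poly n r)) (r i))"
        using True by (intro mult_pos_pos pderiv_sign_at_root sorted i)
      then show ?thesis
        using i by (simp add: g_def at_root algebra_simps)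
    next
      case False
      then show ?thesis
        using that K(2) by (simp add: g_def uminus_power_if)
    qed
    then obtain t where t: "?p = roots_poly n t" "\<And>i. i < n \<Longrightarrow> g i < t i" "\<And>i. i < n \<Longrightarrow> t i < g (Suc i)"
      using roots_between_alternations[OF deg lead, of g] g by blast
    have "0 < (-1) ^ (n + i + 1) * (c * poly (roots_poly n r) (t i))" if "i < n" for i
    proof -
      have "0 < (-1) ^ (n + Suc i) * poly (roots_poly n r) (t i)"
      proof (rule roots_poly_sign)
        show "r l < t i" if "l < Suc i" for l
          using t(2)[of i] less[of l i] that \<open>i < n\<close> by (cases "l = i") (auto simp: g_def)
        show "t i < r l" if "Suc i \<le> l" "l < n" for l
          using t(3)[of i] less[of "Suc i" l] that \<open>i < n\<close> by (cases "l = Suc i") (auto simp: g_def)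
      qed (use that in simp)
      from mult_pos_pos[OF True this] show ?thesis
        by (simp add: algebra_simps)
    qed
    moreover have "t i < t (Suc i)" if "Suc i < n" for i
      using t(2)[of "Suc i"] t(3)[of i] that by simp
    ultimately show thesis
      using that t(1) by blast
  next
    case False
    with \<open>c \<noteq> 0\<close> have c: "0 < - c"
      by simp
    \<comment> \<open>For negative \<open>c\<close> the extra sign change lies to the left of the
      zeros of p, so \<open>- K\<close> comes first and the indices shift by one: now
      \<open>t i\<close> precedes \<open>r i\<close>.\<close>
    define g where "g = (\<lambda>i. case i of 0 \<Rightarrow> - K | Suc j \<Rightarrow> r j)"
    have g: "g i < g (Suc i)" if "i < n" for i
      using sorted[of "i - 1"] K_bound[of i] that by (auto simp: g_def split: nat.split)
    have "0 < (-1) ^ (n + i) * poly ?p (g i)" if "i \<le> n" for i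
    proof (cases i)
      case (Suc j)
      then have "j < n"
        using that by simp
      have "0 < - c * ((-1) ^ (n + j + 1) * poly (pderiv (roots_poly n r)) (r j))"
        by (intro mult_pos_pos pderiv_sign_at_root sorted \<open>j < n\<close> c)
      then show ?thesis
        using \<open>j < n\<close> Suc by (simp add: g_def at_root algebra_simps)
    next
      case 0
      then show ?thesis
        using K(3) by (simp add: g_def)
    qed
    then obtain t where t: "?p = roots_poly n t" "\<And>i. i < n \<Longrightarrow> g i < t i" "\<And>i. i < n \<Longrightarrow> t i < g (Suc i)"
      using roots_between_alternations[OF deg lead, of g] g by blast
    have "0 < (-1) ^ (n + i + 1) * (c * poly (roots_poly n r) (t i))" if "i < n" for i
    proof -
      have "0 < (-1) ^ (n + i) * poly (roots_poly n r) (t i)"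
      proof (rule roots_poly_sign)
        show "r l < t i" if "l < i" for l
          using t(2)[of i] less[of l "i - 1"] that \<open>i < n\<close>
          by (cases "l = i - 1") (auto simp: g_def split: nat.splits)
        show "t i < r l" if "i \<le> l" "l < n" for l
          using t(3)[of i] less[of i l] that \<open>i < n\<close> by (cases "l = i") (auto simp: g_def)
      qed (use that in simp)
      from mult_pos_pos[OF c this] show ?thesis
        by (simp add: algebra_simps)
    qed
    moreover have "t i < t (Suc i)" if "Suc i < n" for i
      using t(2)[of "Suc i"] t(3)[of i] that by simp
    ultimately show thesis
      using that t(1) by blast
  qed
qed

section \<open>Order relations and construction of interlacing families\<close>

lemma interlaces_sorted:
  assumes "interlaces n m w"
  shows "i < n \<Longrightarrow> m i < m (Suc i)" "Suc i < n \<Longrightarrow> w i < w (Suc i)"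
proof -
  show "m i < m (Suc i)" if "i < n"
    using assms that unfolding interlaces_def by (blast intro: less_trans)
  show "w i < w (Suc i)" if "Suc i < n"
    using assms that unfolding interlaces_def by (blast intro: less_trans Suc_lessD)
qed

lemma interlaces_less:
  assumes "interlaces n m w"
  shows "i \<le> n \<Longrightarrow> k < i \<Longrightarrow> m k < m i" "i < n \<Longrightarrow> k < i \<Longrightarrow> w k < w i"
  using adjacent_less[of "Suc n" m k i] adjacent_less[of n w k i] interlaces_sorted[OF assms] by auto

lemma interlaces_cross:
  assumes "interlaces n m w"
  shows "i \<le> n \<Longrightarrow> k < i \<Longrightarrow> w k < m i" "k < n \<Longrightarrow> i \<le> k \<Longrightarrow> m i < w k"
proof -
  show "w k < m i" if "i \<le> n" "k < i"
    using assms interlaces_less(1)[OF assms, of i "Suc k"] that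
    unfolding interlaces_def
    by (cases "Suc k = i") (metis Suc_le_lessD Suc_lessI less_le_trans less_trans)+
  show "m i < w k" if "k < n" "i \<le> k"
    using assms interlaces_less(1)[OF assms, of k i] that
    unfolding interlaces_def by (cases "i = k") force+
qed

text \<open>At the zeros \<open>t\<close> of T p the value of T ((x - e) p) is - c p, whose signs
  alternate. As \<open>t\<close> is chosen before \<open>e\<close>, the same zeros serve for every
  additional factor.\<close>

lemma hp_op_interlaces:
  assumes "c \<noteq> 0" and sorted: "\<And>i. Suc i < n \<Longrightarrow> r i < r (Suc i)"
  obtains t where "hp_op c (roots_poly n r) = roots_poly n t"
    and "\<And>i. Suc i < n \<Longrightarrow> t i < t (Suc i)"
    and "\<And>e. \<exists>m. hp_op c ([:- e, 1:] * roots_poly n r) = roots_poly (Suc n) m \<and> interlaces n m t"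
proof -
  obtain t where t: "hp_op c (roots_poly n r) = roots_poly n t"
    "\<And>i. Suc i < n \<Longrightarrow> t i < t (Suc i)"
    "\<And>i. i < n \<Longrightarrow> 0 < (-1) ^ (n + i + 1) * (c * poly (roots_poly n r) (t i))"
    using hp_op_simple_roots[of c n r] assms by metis
  have "\<exists>m. hp_op c ([:- e, 1:] * roots_poly n r) = roots_poly (Suc n) m \<and> interlaces n m t" for e
  proof -
    let ?p = "hp_op c ([:- e, 1:] * roots_poly n r)"
    have deg: "degree ?p = Suc n"
      by (simp only: degree_hp_op) (subst degree_mult_eq; simp)
    have lead: "lead_coeff ?p = 1"
      by (simp only: lead_coeff_hp_op lead_coeff_mult) simp
    obtain K where K: "Max (insert 0 ((\<lambda>i. \<bar>t i\<bar>) ` {..<n})) < K" "0 < poly ?p K"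
      "0 < (-1) ^ Suc n * poly ?p (- K)"
      using monic_ends[OF lead] unfolding deg by blast
    have K_bound: "\<bar>t i\<bar> < K" if "i < n" for i
      using K(1) that by simp
    have "0 < K"
      using K(1) by simp
    \<comment> \<open>For \<open>n + 1\<close> zeros there are \<open>n + 2\<close> sample points:
      the values of \<open>t\<close>, with \<open>- K\<close> and \<open>K\<close> at the
      ends.\<close>
    define g where "g = (\<lambda>i. case i of 0 \<Rightarrow> - K | Suc j \<Rightarrow> if j < n then t j else K)"
    have g: "g i < g (Suc i)" if "i < Suc n" for i
      using t(2)[of "i - 1"] K_bound[of i] K_bound[of "i - 1"] \<open>0 < K\<close> that
      by (auto simp: g_def split: nat.split)
    have "0 < (-1) ^ (Suc n + i) * poly ?p (g i)" if "i \<le> Suc n" for i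
    proof (cases i)
      case (Suc j)
      show ?thesis
      proof (cases "j < n")
        case True
        then have "poly (hp_op c (roots_poly n r)) (t j) = 0"
          by (simp add: t(1) poly_roots_poly_eq_0_iff)
        then show ?thesis
          using True Suc t(3)[of j] unfolding g_def poly_hp_op_linear_mult by simp
      next
        case False
        then show ?thesis
          using that Suc K(2) by (simp add: g_def uminus_power_if)
      qed
    next
      case 0
      then show ?thesis
        using K(3) by (simp add: g_def)
    qed
    then obtain m where m: "?p = roots_poly (Suc n) m" "\<And>i. i < Suc n \<Longrightarrow> g i < m i"
      "\<And>i. i < Suc n \<Longrightarrow> m i < g (Suc i)"
      using roots_between_alternations[OF deg lead, of g] g by blast
    have "m i < t i \<and> t i < m (Suc i)" if "i < n" for i
      using m(2)[of "Suc i"] m(3)[of i] that by (simp add: g_def)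
    then show ?thesis
      using m(1) unfolding interlaces_def by blast
  qed
  then show thesis
    using that t(1,2) by blast
qed

text \<open>At \<open>m i\<close> only the term with \<open>s\<close> survives, at
  \<open>w i\<close> only the first polynomial; interlacing makes these signs opposite, so a zero
  lies between \<open>m i\<close> and \<open>w i\<close>.\<close>

lemma interlacing_shift:
  assumes int: "interlaces n m w" and "s > 0"
  obtains y where "roots_poly (Suc n) m - smult s (roots_poly n w) = roots_poly (Suc n) y"
    and "\<And>i. i \<le> n \<Longrightarrow> m i < y i" "\<And>i. i < n \<Longrightarrow> y i < w i"
proof -
  let ?p = "roots_poly (Suc n) m - smult s (roots_poly n w)"
  have "degree (- smult s (roots_poly n w)) < degree (roots_poly (Suc n) m)"
    using \<open>s > 0\<close> by simp
  then have deg: "degree ?p = Suc n"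
    using degree_add_eq_left[of "- smult s (roots_poly n w)" "roots_poly (Suc n) m"] by simp
  have lead: "lead_coeff ?p = 1"
    unfolding deg by (simp add: coeff_eq_0)
  obtain K where K: "m n < K" "0 < poly ?p K"
    using monic_ends[OF lead, of "m n"] by blast
  \<comment> \<open>The largest zero has no \<open>w i\<close> above it; a far point
    \<open>K\<close> closes its bracket.\<close>
  define hi where "hi = (\<lambda>i. if i < n then w i else K)"
  have at_m: "0 < (-1) ^ (n + i + 1) * poly ?p (m i)" if "i \<le> n" for i
  proof -
    have "poly (roots_poly (Suc n) m) (m i) = 0"
      using that by (simp add: poly_roots_poly_eq_0_iff)
    moreover have "0 < (-1) ^ (n + i) * poly (roots_poly n w) (m i)"
      using interlaces_cross[OF int] that by (intro roots_poly_sign) auto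
    then have "0 < s * ((-1) ^ (n + i) * poly (roots_poly n w) (m i))"
      using \<open>s > 0\<close> by (rule mult_pos_pos[rotated])
    ultimately show ?thesis
      by (simp add: algebra_simps)
  qed
  have at_hi: "0 < (-1) ^ (Suc n + Suc i) * poly ?p (hi i)" if "i \<le> n" for i
  proof (cases "i < n")
    case True
    have "poly (roots_poly n w) (w i) = 0"
      using True by (simp add: poly_roots_poly_eq_0_iff)
    moreover have "0 < (-1) ^ (Suc n + Suc i) * poly (roots_poly (Suc n) m) (w i)"
      using interlaces_cross[OF int] True by (intro roots_poly_sign) auto
    ultimately show ?thesis
      using True by (simp add: hi_def)
  next
    case False
    then show ?thesis
      using that K(2) by (simp add: hi_def uminus_power_if)
  qed
  have "m i < hi i" if "i < Suc n" for i
    using int K(1) that by (auto simp: hi_def interlaces_def less_Suc_eq)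
  moreover have "poly ?p (m i) * poly ?p (hi i) < 0" if "i < Suc n" for i
    using at_m[of i] at_hi[of i] that by (intro opposite_signs[of "n + i + 1"]) auto
  moreover have "hi i \<le> m (Suc i)" if "Suc i < Suc n" for i
    using int that by (auto simp: hi_def interlaces_def less_imp_le)
  ultimately obtain y where y: "?p = roots_poly (Suc n) y"
    "\<And>i. i < Suc n \<Longrightarrow> m i < y i" "\<And>i. i < Suc n \<Longrightarrow> y i < hi i"
    using roots_in_brackets[OF deg lead, of m hi] by blast
  have "y i < w i" if "i < n" for i
    using y(3)[of i] that by (simp add: hi_def)
  then show thesis
    using that[of y] y(1,2) less_Suc_eq_le by blast
qed

section \<open>Pinching two zeros of a polynomial with simple zeros\<close>

text \<open>Convexity bounds \<open>f (z i)\<close> by \<open>f (y i)\<close> plus a linear term in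
  \<open>z i - y i\<close>. The slope is the same for all \<open>i\<close>, because all points move
  towards the same \<open>p\<close>, and the linear terms cancel as the sums agree.\<close>

lemma sum_convex_segment_le:
  fixes f :: "real \<Rightarrow> real"
  assumes f: "convex_on UNIV f" and sum: "sum z I = sum y I"
    and seg: "\<And>i. i \<in> I \<Longrightarrow> z i \<in> closed_segment p (y i)"
  shows "(\<Sum>i\<in>I. f (z i)) \<le> (\<Sum>i\<in>I. f (y i))"
proof -
  \<comment> \<open>\<open>d\<close> is the slope of a supporting line of \<open>f\<close> at
    \<open>p\<close>.\<close>
  obtain d where d: "\<And>x. f p + d * (x - p) \<le> f x"
    using convex_le_Inf_differential[OF f, of p] by (metis UNIV_I interior_UNIV)
  have "f (z i) \<le> f (y i) + d * (z i - y i)" if "i \<in> I" for i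
  proof -
    obtain u where u: "0 \<le> u" "u \<le> 1" "z i = (1 - u) * p + u * y i"
      using seg[OF \<open>i \<in> I\<close>] by (auto simp: closed_segment_def)
    have "f (z i) \<le> (1 - u) * f p + u * f (y i)"
      using convex_onD[OF f, of u p "y i"] u by simp
    \<comment> \<open>The supporting line at \<open>p\<close>, read at \<open>y i\<close>, bounds
      \<open>f p\<close> from above.\<close>
    also have "\<dots> \<le> (1 - u) * (f (y i) - d * (y i - p)) + u * f (y i)"
      using d[of "y i"] u by (intro add_right_mono mult_left_mono) auto
    also have "\<dots> = f (y i) + d * (z i - y i)"
      unfolding u(3) by (simp add: algebra_simps)
    finally show ?thesis .
  qed
  then have "(\<Sum>i\<in>I. f (z i)) \<le> (\<Sum>i\<in>I. f (y i) + d * (z i - y i))"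
    by (rule sum_mono)
  also have "\<dots> = (\<Sum>i\<in>I. f (y i))"
    using sum by (simp add: sum.distrib sum_subtractf flip: sum_distrib_left)
  finally show ?thesis .
qed

text \<open>At the zeros of M - s U, the sign of M - s V is governed by the zeros common to
  \<open>u\<close> and \<open>v\<close>. These miss index \<open>j\<close>, so relative to the usual
  alternation the sign flips after \<open>j\<close>, and with it the direction in which the zeros
  move.\<close>

lemma raise_one_root:
  fixes f :: "real \<Rightarrow> real"
  assumes mu: "interlaces n m u" and mv: "interlaces n m v"
    and "j < n" "u j \<le> v j" and uv: "\<And>i. i < n \<Longrightarrow> i \<noteq> j \<Longrightarrow> u i = v i" and "0 < s"
    and y: "roots_poly (Suc n) m - smult s (roots_poly n u) = roots_poly (Suc n) y"
      "\<And>i. i \<le> n \<Longrightarrow> m i < y i" "\<And>i. i < n \<Longrightarrow> y i < u i"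
    and z: "roots_poly (Suc n) m - smult s (roots_poly n v) = roots_poly (Suc n) z"
      "\<And>i. i \<le> n \<Longrightarrow> m i < z i" "\<And>i. i < n \<Longrightarrow> z i < v i"
    and f: "convex_on UNIV f"
  shows "(\<Sum>i\<le>n. f (z i)) \<le> (\<Sum>i\<le>n. f (y i))"
proof (rule sum_convex_segment_le[OF f])
  \<comment> \<open>Both subtracted terms have the coefficient \<open>s\<close> in degree
    \<open>n\<close>, so the sums of zeros coincide.\<close>
  have "coeff (roots_poly (Suc n) z) n = coeff (roots_poly (Suc n) y) n"
    unfolding y(1)[symmetric] z(1)[symmetric] by simp
  then show "sum z {..n} = sum y {..n}"
    by (simp add: coeff_roots_poly_sum)
  define W where "W = (\<lambda>x. \<Prod>l\<in>{..<n} - {j}. x - u l)"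
  have diff: "poly (roots_poly (Suc n) z) x = s * (v j - u j) * W x"
    if "poly (roots_poly (Suc n) y) x = 0" for x
  proof -
    have U: "poly (roots_poly n u) x = (x - u j) * W x"
      unfolding poly_roots_poly W_def using \<open>j < n\<close> by (intro prod.remove) auto
    have "poly (roots_poly n v) x = (x - v j) * (\<Prod>l\<in>{..<n} - {j}. x - v l)"
      unfolding poly_roots_poly using \<open>j < n\<close> by (intro prod.remove) auto
    moreover have "(\<Prod>l\<in>{..<n} - {j}. x - v l) = W x"
      unfolding W_def using uv by (intro prod.cong) auto
    ultimately have V: "poly (roots_poly n v) x = (x - v j) * W x"
      by simp
    have Z: "poly (roots_poly (Suc n) z) x = s * (poly (roots_poly n u) x - poly (roots_poly n v) x)"
      using that unfolding y(1)[symmetric] z(1)[symmetric] by (simp add: algebra_simps)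
    show ?thesis
      unfolding Z U V by (simp add: algebra_simps)
  qed
  have y_less: "y i < u l" if "i \<le> l" "l < n" for i l
    using y(3)[of i] interlaces_less(2)[OF mu, of l i] that by (cases "i = l") auto
  have less_y: "u l < y i" if "l < i" "i \<le> n" for i l
    using y(2)[of i] interlaces_cross(1)[OF mu, of i l] that by simp
  have z_less: "z l < m i" if "l < i" "i \<le> n" for i l
    using z(3)[of l] interlaces_cross(1)[OF mv, of i l] that by simp
  have m_mono: "m i \<le> m l" if "i \<le> l" "l \<le> n" for i l
    using interlaces_less(1)[OF mu, of l i] that by (cases "i = l") auto
  have W_sign: "0 < (-1) ^ card ({i..<n} - {j}) * W (y i)" if "i \<le> n" for i
  proof -
    have "{l \<in> {..<n} - {j}. y i < u l} = {i..<n} - {j}"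
      using y_less[of i] less_y[of _ i] that by (auto simp: not_less) (meson leI less_asym)
    moreover have "y i \<noteq> u l" if "l \<in> {..<n} - {j}" for l
      using y_less[of i l] less_y[of l i] that \<open>i \<le> n\<close> by (cases "i \<le> l") auto
    ultimately show ?thesis
      using prod_diff_sign[of "{..<n} - {j}" "y i" u] by (simp add: W_def)
  qed
  have D_sign: "0 \<le> (-1) ^ card ({i..<n} - {j}) * poly (roots_poly (Suc n) z) (y i)" if "i \<le> n" for i
  proof -
    have "poly (roots_poly (Suc n) y) (y i) = 0"
      using that by (simp add: poly_roots_poly_eq_0_iff)
    then have "(-1) ^ card ({i..<n} - {j}) * poly (roots_poly (Suc n) z) (y i)
        = s * (v j - u j) * ((-1) ^ card ({i..<n} - {j}) * W (y i))"
      by (simp add: diff algebra_simps)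
    also have "0 \<le> \<dots>"
      using \<open>0 < s\<close> \<open>u j \<le> v j\<close>
      by (intro mult_nonneg_nonneg[OF mult_nonneg_nonneg] less_imp_le[OF W_sign[OF that]]) auto
    finally show ?thesis .
  qed
  \<comment> \<open>Otherwise \<open>y i\<close> would lie strictly between \<open>z i\<close> and
    \<open>z (Suc i)\<close>, where the sign is opposite to the one in
    \<open>D_sign\<close>.\<close>
  have low: "y i \<le> z i" if "i \<le> j" for i
  proof (rule ccontr)
    assume "\<not> y i \<le> z i"
    have "0 < (-1) ^ (Suc n + Suc i) * poly (roots_poly (Suc n) z) (y i)"
    proof (rule roots_poly_sign)
      show "z l < y i" if "l < Suc i" for l
        using that z_less[of l i] y(2)[of i] \<open>\<not> y i \<le> z i\<close> \<open>i \<le> j\<close> \<open>j < n\<close> by (cases "l = i") auto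
      show "y i < z l" if "Suc i \<le> l" "l < Suc n" for l
        using that y(3)[of i] interlaces_cross(1)[OF mu, of l i] z(2)[of l] by simp
    qed (use that \<open>j < n\<close> in simp)
    moreover have "card ({i..<n} - {j}) = n - Suc i"
      using that \<open>j < n\<close> by simp
    moreover have "(-1::real) ^ (Suc n + Suc i) = - ((-1) ^ (n - Suc i))"
      using that \<open>j < n\<close> by (simp add: uminus_power_if)
    ultimately show False
      using D_sign[of i] that \<open>j < n\<close> by simp
  qed
  \<comment> \<open>Here \<open>j < i\<close>, so nothing is removed from \<open>{i..<n}\<close>;
    this changes the parity and reverses the direction.\<close>
  have high: "z i \<le> y i" if "j < i" "i \<le> n" for i
  proof (rule ccontr)
    assume "\<not> z i \<le> y i"
    have "0 < (-1) ^ (Suc n + i) * poly (roots_poly (Suc n) z) (y i)"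
    proof (rule roots_poly_sign)
      show "z l < y i" if "l < i" for l
        using that z_less[of l i] y(2)[of i] \<open>i \<le> n\<close> by simp
      show "y i < z l" if "i \<le> l" "l < Suc n" for l
      proof (cases "l = i")
        case False
        then have "y i < m l"
          using that y(3)[of i] interlaces_cross(1)[OF mu, of l i] by simp
        then show ?thesis
          using z(2)[of l] that by simp
      qed (use \<open>\<not> z i \<le> y i\<close> in simp)
    qed (use that in simp)
    moreover have "{i..<n} - {j} = {i..<n}"
      using that by auto
    moreover have "(-1::real) ^ (Suc n + i) = - ((-1) ^ (n - i))"
      using that by (simp add: uminus_power_if)
    ultimately show False
      using D_sign[of i] that by simp
  qed
  \<comment> \<open>The \<open>z i\<close> with \<open>i \<le> j\<close> lie below
    \<open>m (Suc j)\<close> and the others above, so this point is a common target.\<close>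
  show "z i \<in> closed_segment (m (Suc j)) (y i)" if "i \<in> {..n}" for i
  proof (cases "i \<le> j")
    case True
    then have "z i < m (Suc j)"
      using z_less[of i "Suc j"] \<open>j < n\<close> by simp
    then show ?thesis
      using low[OF True] by (simp add: closed_segment_eq_real_ivl)
  next
    case False
    then have "m (Suc j) < z i"
      using that m_mono[of "Suc j" i] z(2)[of i] by simp
    then show ?thesis
      using high[of i] False that by (simp add: closed_segment_eq_real_ivl)
  qed
qed

lemma raise_roots:
  assumes mu: "interlaces n m u" and mv: "interlaces n m v"
    and uv: "\<And>i. i < n \<Longrightarrow> u i \<le> v i" and "0 < s"
  obtains y z where "roots_poly (Suc n) m - smult s (roots_poly n u) = roots_poly (Suc n) y"
    and "roots_poly (Suc n) m - smult s (roots_poly n v) = roots_poly (Suc n) z"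
    and "\<And>f. convex_on UNIV f \<Longrightarrow> (\<Sum>i\<le>n. f (z i)) \<le> (\<Sum>i\<le>n. f (y i))"
proof -
  \<comment> \<open>The first \<open>k\<close> zeros are those of \<open>v\<close>, the rest those
    of \<open>u\<close>. Every such mixture interlaces \<open>m\<close>, so single raises can be
    chained from \<open>u\<close> to \<open>v\<close>.\<close>
  define h where "h = (\<lambda>k l. if l < k then v l else u l)"
  have mh: "interlaces n m (h k)" for k
    using mu mv by (simp add: interlaces_def h_def)
  have "\<exists>y. roots_poly (Suc n) m - smult s (roots_poly n (h k)) = roots_poly (Suc n) y \<and>
      (\<forall>i\<le>n. m i < y i) \<and> (\<forall>i<n. y i < h k i)" for k
    using interlacing_shift[OF mh \<open>0 < s\<close>] by metis
  then obtain Y where Y: "\<And>k. roots_poly (Suc n) m - smult s (roots_poly n (h k)) = roots_poly (Suc n) (Y k)"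
    "\<And>k i. i \<le> n \<Longrightarrow> m i < Y k i" "\<And>k i. i < n \<Longrightarrow> Y k i < h k i"
    by metis
  have "(\<Sum>i\<le>n. f (Y k i)) \<le> (\<Sum>i\<le>n. f (Y 0 i))" if "k \<le> n" "convex_on UNIV f" for k and f :: "real \<Rightarrow> real"
    using that(1)
  proof (induction k)
    case (Suc k)
    have "(\<Sum>i\<le>n. f (Y (Suc k) i)) \<le> (\<Sum>i\<le>n. f (Y k i))"
      using Suc.prems uv
      by (intro raise_one_root[OF mh mh _ _ _ \<open>0 < s\<close> Y Y that(2), of k]) (auto simp: h_def less_Suc_eq)
    then show ?case
      using Suc by simp
  qed simp
  moreover have "roots_poly n (h 0) = roots_poly n u" "roots_poly n (h n) = roots_poly n v"
    by (auto intro!: roots_poly_cong simp: h_def)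
  ultimately show thesis
    using that[of "Y 0" "Y n"] Y(1) by (metis order_refl)
qed

lemma roots_poly_of_finite_set:
  assumes "finite S"
  obtains r where "roots_poly (card S) r = (\<Prod>x\<in>S. [:- x, 1:])"
    and "\<And>i. Suc i < card S \<Longrightarrow> r i < r (Suc i)"
proof -
  let ?l = "sorted_list_of_set S"
  have len: "length ?l = card S"
    by simp
  have "roots_poly (card S) ((!) ?l) = (\<Prod>x\<in>S. [:- x, 1:])"
    unfolding roots_poly_def
    by (rule prod.reindex_bij_betw, rule bij_betw_nth) (use assms in auto)
  moreover have "?l ! i < ?l ! Suc i" if "Suc i < card S" for i
    using strict_sorted_list_of_set[of S] that len by (metis lessI sorted_wrt_nth_less)
  ultimately show thesis
    using that by blast
qed

text \<open>Distinctness concerns \<open>a\<close>, \<open>b\<close> and \<open>S\<close>, because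
  simple zeros are used for \<open>R\<close> and for \<open>R\<close> times one of the factors;
  \<open>a + s\<close> and \<open>b + s\<close> may coincide with points of
  \<open>S\<close>.\<close>

lemma pinch_simple_roots:
  fixes S :: "real set"
  assumes "c \<noteq> 0" "finite S" "a \<notin> S" "b \<notin> S" "a < b" "0 < s"
  defines "R \<equiv> \<Prod>x\<in>S. [:- x, 1:]" and "n \<equiv> Suc (card S)"
  obtains y z where "hp_op c ([:- a, 1:] * [:- (b + s), 1:] * R) = roots_poly (Suc n) y"
    and "hp_op c ([:- (a + s), 1:] * [:- b, 1:] * R) = roots_poly (Suc n) z"
    and "\<And>f. convex_on UNIV f \<Longrightarrow> (\<Sum>i\<le>n. f (z i)) \<le> (\<Sum>i\<le>n. f (y i))"
proof -
  \<comment> \<open>Applied to \<open>S\<close>, \<open>insert a S\<close> and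
    \<open>insert b S\<close>, this gives the zeros of T R, U and V and their interlacing with the
    next degree.\<close>
  have main: "\<exists>t. hp_op c (\<Prod>x\<in>A. [:- x, 1:]) = roots_poly (card A) t \<and>
      (\<forall>i. Suc i < card A \<longrightarrow> t i < t (Suc i)) \<and>
      (\<forall>e. \<exists>m. hp_op c ([:- e, 1:] * (\<Prod>x\<in>A. [:- x, 1:])) = roots_poly (Suc (card A)) m \<and>
        interlaces (card A) m t)" if "finite A" for A
  proof -
    obtain r where r: "roots_poly (card A) r = (\<Prod>x\<in>A. [:- x, 1:])"
      "\<And>i. Suc i < card A \<Longrightarrow> r i < r (Suc i)"
      using roots_poly_of_finite_set[OF \<open>finite A\<close>] by blast
    show ?thesis
      by (rule hp_op_interlaces[of c "card A" r]) (use \<open>c \<noteq> 0\<close> r in auto)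
  qed
  have card: "card (insert a S) = n" "card (insert b S) = n"
    using assms by (auto simp: n_def)
  have prod: "(\<Prod>x\<in>insert a S. [:- x, 1:]) = [:- a, 1:] * R"
    "(\<Prod>x\<in>insert b S. [:- x, 1:]) = [:- b, 1:] * R"
    using assms by (auto simp: R_def)
  obtain t u0 where t: "hp_op c R = roots_poly (card S) t"
    "hp_op c ([:- a, 1:] * R) = roots_poly n u0" "interlaces (card S) u0 t"
    using main[OF \<open>finite S\<close>] unfolding R_def n_def by blast
  obtain u m where u: "hp_op c ([:- a, 1:] * R) = roots_poly n u" "\<And>i. Suc i < n \<Longrightarrow> u i < u (Suc i)"
    "hp_op c ([:- b, 1:] * ([:- a, 1:] * R)) = roots_poly (Suc n) m" "interlaces n m u"
    using main[of "insert a S"] \<open>finite S\<close> unfolding card prod by blast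
  obtain v m' where v: "hp_op c ([:- b, 1:] * R) = roots_poly n v" "\<And>i. Suc i < n \<Longrightarrow> v i < v (Suc i)"
    "hp_op c ([:- a, 1:] * ([:- b, 1:] * R)) = roots_poly (Suc n) m'" "interlaces n m' v"
    using main[of "insert b S"] \<open>finite S\<close> unfolding card prod by blast
  \<comment> \<open>\<open>m\<close> and \<open>m'\<close> come from separate applications but list
    the zeros of one polynomial M in increasing order, so they agree.\<close>
  have "roots_poly (Suc n) m = roots_poly (Suc n) m'"
    unfolding u(3)[symmetric] v(3)[symmetric] by (simp only: mult.left_commute)
  then have "m i = m' i" if "i \<le> n" for i
    using strictly_sorted_unique[of "Suc n" m m' i] interlaces_sorted(1)[OF u(4)]
      interlaces_sorted(1)[OF v(4)] that by simp
  then have mv: "interlaces n m v"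
    using v(4) by (simp add: interlaces_def)
  have "u0 i = u i" if "i < n" for i
    using strictly_sorted_unique[of n u0 u i] interlaces_sorted(1)[OF t(3)] u(1,2) t(2) that
    by (simp add: n_def)
  then have ut: "interlaces (card S) u t"
    using t(3) by (simp add: interlaces_def n_def)
  \<comment> \<open>V arises from U by subtracting \<open>b - a\<close> times T R, whose zeros
    interlace those of U, so each zero of V lies above the corresponding zero of U.\<close>
  have "0 < b - a"
    using \<open>a < b\<close> by simp
  then obtain v0 where v0: "roots_poly n u - smult (b - a) (roots_poly (card S) t) = roots_poly n v0"
    "\<And>i. i \<le> card S \<Longrightarrow> u i < v0 i" "\<And>i. i < card S \<Longrightarrow> v0 i < t i"
    using interlacing_shift[OF ut] unfolding n_def by blast
  have "[:- b, 1:] * R = [:- a, 1:] * R - smult (b - a) R"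
    by (simp add: algebra_simps smult_diff_left)
  then have "hp_op c ([:- b, 1:] * R) = hp_op c ([:- a, 1:] * R) - smult (b - a) (hp_op c R)"
    by (simp only: hp_op_diff hp_op_smult)
  then have "roots_poly n v0 = roots_poly n v"
    using v0(1) t(1) u(1) v(1) by simp
  moreover have "v0 i < v0 (Suc i)" if "Suc i < n" for i
    using that v0(2)[of "Suc i"] v0(3)[of i] ut unfolding interlaces_def n_def by force
  ultimately have "v0 i = v i" if "i < n" for i
    using strictly_sorted_unique[of n v0 v i] v(2) that by blast
  then have uv: "u i \<le> v i" if "i < n" for i
    using v0(2)[of i] that by (simp add: n_def)
  \<comment> \<open>Shifting one zero up by \<open>s\<close> subtracts \<open>s\<close> times the
    product of the remaining factors.\<close>
  have "[:- a, 1:] * [:- (b + s), 1:] * R = [:- b, 1:] * ([:- a, 1:] * R) - smult s ([:- a, 1:] * R)"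
    "[:- (a + s), 1:] * [:- b, 1:] * R = [:- b, 1:] * ([:- a, 1:] * R) - smult s ([:- b, 1:] * R)"
    by (simp_all add: algebra_simps smult_diff_left smult_add_left smult_add_right smult_diff_right)
  then have eqs: "hp_op c ([:- a, 1:] * [:- (b + s), 1:] * R) = roots_poly (Suc n) m - smult s (roots_poly n u)"
    "hp_op c ([:- (a + s), 1:] * [:- b, 1:] * R) = roots_poly (Suc n) m - smult s (roots_poly n v)"
    by (simp_all only: hp_op_diff hp_op_smult u(1,3) v(1))
  show thesis
    using raise_roots[OF u(4) mv uv \<open>0 < s\<close>] that unfolding eqs by blast
qed

section \<open>Limits of polynomials with real zeros\<close>

text \<open>A bound of Cauchy type: when the absolute value exceeds 1, divide the equation for the
  zero by its power of order \<open>n - 1\<close>.\<close>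

lemma roots_poly_root_bound:
  assumes "i < n"
  shows "\<bar>y i\<bar> \<le> 1 + (\<Sum>j<n. \<bar>coeff (roots_poly n y) j\<bar>)"
proof (cases "\<bar>y i\<bar> \<le> 1")
  case False
  let ?c = "coeff (roots_poly n y)"
  obtain n' where n: "n = Suc n'"
    using assms by (cases n) auto
  have "0 = poly (roots_poly n y) (y i)"
    using assms by (simp add: poly_roots_poly_eq_0_iff)
  also have "\<dots> = (\<Sum>j<n. ?c j * y i ^ j) + y i ^ n"
    by (simp add: poly_altdef lessThan_Suc_atMost[symmetric])
  finally have "\<bar>y i\<bar> ^ n = \<bar>\<Sum>j<n. ?c j * y i ^ j\<bar>"
    by (simp flip: power_abs)
  also have "\<dots> \<le> (\<Sum>j<n. \<bar>?c j * y i ^ j\<bar>)"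
    by (rule sum_abs)
  also have "\<dots> \<le> (\<Sum>j<n. \<bar>?c j\<bar> * \<bar>y i\<bar> ^ n')"
    using False n by (intro sum_mono) (auto simp: abs_mult power_abs intro!: mult_left_mono power_increasing)
  finally have "\<bar>y i\<bar> * \<bar>y i\<bar> ^ n' \<le> (\<Sum>j<n. \<bar>?c j\<bar>) * \<bar>y i\<bar> ^ n'"
    by (simp add: n sum_distrib_right del: sum.lessThan_Suc)
  then have "\<bar>y i\<bar> \<le> (\<Sum>j<n. \<bar>?c j\<bar>)"
    by (rule mult_right_le_imp_le) (use False in auto)
  then show ?thesis
    by simp
next
  case True
  have "0 \<le> (\<Sum>j<n. \<bar>coeff (roots_poly n y) j\<bar>)"
    by (intro sum_nonneg) simp
  with True show ?thesis
    by linarith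
qed

text \<open>Bolzano-Weierstrass in one coordinate after the other, passing to a further subsequence
  each time.\<close>

lemma bounded_coordinates_convergent_subsequence:
  fixes y :: "nat \<Rightarrow> nat \<Rightarrow> real"
  assumes "\<And>k i. i < n \<Longrightarrow> \<bar>y k i\<bar> \<le> B"
  shows "\<exists>r z. strict_mono (r :: nat \<Rightarrow> nat) \<and> (\<forall>i<n. (\<lambda>k. y (r k) i) \<longlonglongrightarrow> z i)"
  using assms
proof (induction n)
  case 0
  show ?case
    by (intro exI[of _ "\<lambda>k. k"]) (simp add: strict_mono_def)
next
  case (Suc n)
  then obtain r z where r: "strict_mono (r :: nat \<Rightarrow> nat)" "\<And>i. i < n \<Longrightarrow> (\<lambda>k. y (r k) i) \<longlonglongrightarrow> z i"
    by (metis less_SucI)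
  have "bounded (range (\<lambda>k. y (r k) n))"
    using Suc.prems by (intro boundedI[of _ B]) auto
  then obtain l s where s: "strict_mono (s :: nat \<Rightarrow> nat)" "(\<lambda>k. y (r (s k)) n) \<longlonglongrightarrow> l"
    using bounded_imp_convergent_subsequence[of "\<lambda>k. y (r k) n"] by (auto simp: comp_def)
  have "(\<lambda>k. y ((r \<circ> s) k) i) \<longlonglongrightarrow> (z(n := l)) i" if "i < Suc n" for i
    using that s(2) LIMSEQ_subseq_LIMSEQ[OF r(2) s(1), of i] by (cases "i = n") (auto simp: comp_def)
  moreover have "strict_mono (r \<circ> s)"
    using r(1) s(1) by (rule strict_mono_o)
  ultimately show ?case
    by blast
qed

lemma tendsto_coeff_roots_poly:
  assumes "\<And>i. i < n \<Longrightarrow> (\<lambda>k. y k i) \<longlonglongrightarrow> z i"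
  shows "(\<lambda>k. coeff (roots_poly n (y k)) j) \<longlonglongrightarrow> coeff (roots_poly n z) j"
  using assms
proof (induction n arbitrary: j)
  case (Suc n)
  have coeff: "coeff (roots_poly (Suc n) w) j = (case j of 0 \<Rightarrow> 0 | Suc j' \<Rightarrow> coeff (roots_poly n w) j')
      - w n * coeff (roots_poly n w) j" for w j
    by (simp add: roots_poly_Suc coeff_pCons split: nat.split)
  show ?case
    unfolding coeff using Suc by (cases j) (auto intro!: tendsto_intros)
qed (simp add: roots_poly_def)

lemma tendsto_coeff_hp_op:
  assumes "\<And>j. (\<lambda>k. coeff (p k) j) \<longlonglongrightarrow> coeff q j"
  shows "(\<lambda>k. coeff (hp_op c (p k)) j) \<longlonglongrightarrow> coeff (hp_op c q) j"
  unfolding coeff_hp_op by (intro tendsto_intros assms)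

text \<open>Convergent coefficients keep the zeros bounded, so a subsequence of the families of
  zeros converges, and its limit has the coefficients of \<open>q\<close>. Real zeros thus survive
  limits.\<close>

lemma roots_poly_limit:
  assumes "\<And>j. (\<lambda>k. coeff (roots_poly n (y k)) j) \<longlonglongrightarrow> coeff q j"
  obtains r z where "strict_mono (r :: nat \<Rightarrow> nat)" "\<And>i. i < n \<Longrightarrow> (\<lambda>k. y (r k) i) \<longlonglongrightarrow> z i"
    and "q = roots_poly n z"
proof -
  have "(\<lambda>k. 1 + (\<Sum>j<n. \<bar>coeff (roots_poly n (y k)) j\<bar>)) \<longlonglongrightarrow> 1 + (\<Sum>j<n. \<bar>coeff q j\<bar>)"
    by (intro tendsto_intros assms)
  then have "convergent (\<lambda>k. 1 + (\<Sum>j<n. \<bar>coeff (roots_poly n (y k)) j\<bar>))"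
    by (rule convergentI)
  then obtain B where B: "\<And>k. norm (1 + (\<Sum>j<n. \<bar>coeff (roots_poly n (y k)) j\<bar>)) \<le> B"
    using convergent_imp_Bseq BseqE by blast
  have "\<bar>y k i\<bar> \<le> B" if "i < n" for k i
    using roots_poly_root_bound[OF that, of "y k"] B[of k] by (simp add: abs_le_iff)
  then obtain r z where r: "strict_mono (r :: nat \<Rightarrow> nat)" "\<And>i. i < n \<Longrightarrow> (\<lambda>k. y (r k) i) \<longlonglongrightarrow> z i"
    using bounded_coordinates_convergent_subsequence[of n y B] by blast
  have "q = roots_poly n z"
  proof (rule poly_eqI)
    fix j
    have "(\<lambda>k. coeff (roots_poly n (y (r k))) j) \<longlonglongrightarrow> coeff (roots_poly n z) j"
      by (rule tendsto_coeff_roots_poly) (rule r(2))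
    moreover have "(\<lambda>k. coeff (roots_poly n (y (r k))) j) \<longlonglongrightarrow> coeff q j"
      using LIMSEQ_subseq_LIMSEQ[OF assms r(1), of j] by (simp add: comp_def)
    ultimately show "coeff q j = coeff (roots_poly n z) j"
      by (rule LIMSEQ_unique[rotated])
  qed
  then show thesis
    using that r by blast
qed

text \<open>Indices in \<open>J\<close> are for the two zeros to be pinched, which must stay put;
  the other values are moved apart.\<close>

lemma separating_perturbation:
  fixes g :: "nat \<Rightarrow> real"
  assumes "inj_on g J"
  obtains G where "\<And>k. inj_on (G k) {..<n}" "\<And>k l. l \<in> J \<Longrightarrow> G k l = g l"
    and "\<And>l. (\<lambda>k. G k l) \<longlonglongrightarrow> g l"
proof -
  \<comment> \<open>Offsets of different indices differ unless both lie in \<open>J\<close>, so the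
    shifts break every tie at each step \<open>k\<close>; pairs that are distinct already remain so
    from some step on.\<close>
  define e where "e = (\<lambda>l. if l \<in> J then 0 else real (Suc l))"
  define H where "H = (\<lambda>k l. g l + inverse (real (Suc k)) * e l)"
  have lim: "(\<lambda>k. H k l) \<longlonglongrightarrow> g l" for l
  proof -
    have "(\<lambda>k. g l + inverse (real (Suc k)) * e l) \<longlonglongrightarrow> g l + 0 * e l"
      by (intro tendsto_intros LIMSEQ_inverse_real_of_nat)
    then show ?thesis
      by (simp add: H_def)
  qed
  have "\<forall>\<^sub>F k in sequentially. H k l \<noteq> H k l'" if "l \<noteq> l'" for l l'
  proof (cases "g l = g l'")
    case True
    then have "l \<notin> J \<or> l' \<notin> J"
      using assms that by (auto dest: inj_onD)
    then have "e l \<noteq> e l'"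
      using that by (auto simp: e_def)
    then show ?thesis
      using True by (simp add: H_def)
  next
    case False
    have "(\<lambda>k. H k l - H k l') \<longlonglongrightarrow> g l - g l'"
      by (intro tendsto_intros lim)
    then have "\<forall>\<^sub>F k in sequentially. H k l - H k l' \<noteq> 0"
      using False by (intro tendsto_imp_eventually_ne) auto
    then show ?thesis
      by eventually_elim simp
  qed
  then have "\<forall>\<^sub>F k in sequentially. \<forall>l\<in>{..<n}. \<forall>l'\<in>{..<n}. l \<noteq> l' \<longrightarrow> H k l \<noteq> H k l'"
    by (intro eventually_ball_finite ballI) (auto simp: eventually_conj_iff intro: eventually_mono)
  then obtain N where N: "\<And>k. N \<le> k \<Longrightarrow> inj_on (H k) {..<n}"
    unfolding eventually_sequentially inj_on_def by blast
  show thesis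
  proof (rule that[of "\<lambda>k. H (k + N)"])
    show "(\<lambda>k. H (k + N) l) \<longlonglongrightarrow> g l" for l
      using lim by (rule LIMSEQ_ignore_initial_segment)
    show "inj_on (H (k + N)) {..<n}" for k
      by (simp add: N)
    show "H (k + N) l = g l" if "l \<in> J" for k l
      using that by (simp add: H_def e_def)
  qed
qed

text \<open>The Hermite-Poulain theorem, obtained from simple zeros by approximation.\<close>

lemma hp_op_real_rooted: "\<exists>z. hp_op c (roots_poly n y) = roots_poly n z"
proof (cases "c = 0")
  case True
  then show ?thesis
    by (auto simp: hp_op_def)
next
  case False
  obtain G where G: "\<And>k. inj_on (G k) {..<n}" "\<And>l. (\<lambda>k. G k l) \<longlonglongrightarrow> y l"
    using separating_perturbation[of y "{}" n] by auto
  have "\<exists>z. hp_op c (roots_poly n (G k)) = roots_poly n z" for k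
  proof -
    have eq: "roots_poly n (G k) = (\<Prod>x\<in>G k ` {..<n}. [:- x, 1:])" "card (G k ` {..<n}) = n"
      using G(1)[of k] by (simp_all add: roots_poly_def prod.reindex card_image)
    obtain r where r: "roots_poly n r = roots_poly n (G k)" "\<And>i. Suc i < n \<Longrightarrow> r i < r (Suc i)"
      using roots_poly_of_finite_set[of "G k ` {..<n}"] unfolding eq by auto
    show ?thesis
      unfolding r(1)[symmetric] by (rule hp_op_simple_roots[of c n r]) (use False r(2) in auto)
  qed
  then obtain z where z: "\<And>k. hp_op c (roots_poly n (G k)) = roots_poly n (z k)"
    by metis
  have "(\<lambda>k. coeff (roots_poly n (z k)) j) \<longlonglongrightarrow> coeff (hp_op c (roots_poly n y)) j" for j
    unfolding z[symmetric] by (intro tendsto_coeff_hp_op tendsto_coeff_roots_poly G)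
  from roots_poly_limit[OF this] show ?thesis
    by blast
qed

section \<open>Pinching two zeros of an arbitrary real-rooted polynomial\<close>

lemma roots_poly_split2:
  assumes "i < n" "k < n" "i \<noteq> k"
  shows "roots_poly n w = [:- w i, 1:] * [:- w k, 1:] * (\<Prod>l\<in>{..<n} - {i, k}. [:- w l, 1:])"
proof -
  have "{..<n} = insert i (insert k ({..<n} - {i, k}))"
    using assms by auto
  then have "roots_poly n w = (\<Prod>l\<in>insert i (insert k ({..<n} - {i, k})). [:- w l, 1:])"
    unfolding roots_poly_def by simp
  also have "\<dots> = [:- w i, 1:] * ([:- w k, 1:] * (\<Prod>l\<in>{..<n} - {i, k}. [:- w l, 1:]))"
    using assms(3) by (subst prod.insert; simp)+
  finally show ?thesis
    by (simp only: mult.assoc)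
qed

lemma sum_proots_roots_poly: "(\<Sum>x\<in>#proots (roots_poly n y). f x) = (\<Sum>i<n. f (y i))"
  by (simp add: proots_roots_poly image_mset.compositionality comp_def sum_unfold_sum_mset)

lemma hp_op_pinch:
  fixes f :: "real \<Rightarrow> real"
  assumes "c \<noteq> 0" "convex_on UNIV f" and ik: "i < n" "k < n" "i \<noteq> k" and s: "0 \<le> s" "s \<le> y k - y i"
  shows "(\<Sum>x\<in>#proots (hp_op c (roots_poly n (y(i := y i + s, k := y k - s)))). f x)
    \<le> (\<Sum>x\<in>#proots (hp_op c (roots_poly n y)). f x)"
proof (cases "s = 0 \<or> s = y k - y i")
  case True
  \<comment> \<open>For \<open>s = 0\<close> nothing moves, and for the full distance the two zeros
    trade places.\<close>
  have "roots_poly n (y(i := y i + s, k := y k - s)) = roots_poly n y"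
  proof (cases "s = 0")
    case False
    with True have eq: "y i + s = y k" "y k - s = y i"
      by simp_all
    have "(\<Prod>l\<in>{..<n} - {i, k}. [:- (y(i := y k, k := y i)) l, 1:]) = (\<Prod>l\<in>{..<n} - {i, k}. [:- y l, 1:])"
      by (intro prod.cong) auto
    moreover have "(y(i := y k, k := y i)) i = y k" "(y(i := y k, k := y i)) k = y i"
      using ik(3) by simp_all
    ultimately show ?thesis
      unfolding eq roots_poly_split2[OF ik] by (simp only: mult_ac)
  qed simp
  then show ?thesis
    by simp
next
  case False
  \<comment> \<open>The lower zero \<open>y i\<close> plays the part of \<open>a\<close> in
    \<open>pinch_simple_roots\<close>, and \<open>y k\<close> that of \<open>b + s\<close>. With
    \<open>b\<close> at index \<open>k\<close>, the perturbation keeps the other zeros distinct from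
    \<open>y i\<close> and \<open>b\<close>.\<close>
  define b where "b = y k - s"
  have "0 < s" "y i < b"
    using False s by (auto simp: b_def)
  define g where "g = y(k := b)"
  have "inj_on g {i, k}"
    using \<open>y i < b\<close> ik(3) by (auto simp: g_def inj_on_def)
  then obtain G where G: "\<And>m. inj_on (G m) {..<n}" "\<And>m l. l \<in> {i, k} \<Longrightarrow> G m l = g l"
    "\<And>l. (\<lambda>m. G m l) \<longlonglongrightarrow> g l"
    using separating_perturbation[of g "{i, k}" n] by metis
  \<comment> \<open>\<open>P\<close> perturbs the zeros before the pinch, \<open>Q\<close> those
    after it.\<close>
  define P where "P = (\<lambda>m. (G m)(k := b + s))"
  define Q where "Q = (\<lambda>m. (G m)(i := y i + s))"
  have Gik: "G m i = y i" "G m k = b" for m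
    using G(2) ik(3) by (auto simp: g_def)
  have "\<exists>Y Z. hp_op c (roots_poly n (P m)) = roots_poly n Y \<and> hp_op c (roots_poly n (Q m)) = roots_poly n Z \<and>
      (\<Sum>i<n. f (Z i)) \<le> (\<Sum>i<n. f (Y i))" for m
  proof -
    define S where "S = G m ` ({..<n} - {i, k})"
    have inj: "inj_on (G m) ({..<n} - {i, k})"
      using G(1) by (rule inj_on_subset) auto
    have "card S = n - 2"
      using ik inj by (simp add: S_def card_image)
    then have n: "n = Suc (Suc (card S))"
      using ik by simp
    have prods: "(\<Prod>l\<in>{..<n} - {i, k}. [:- P m l, 1:]) = (\<Prod>x\<in>S. [:- x, 1:])"
      "(\<Prod>l\<in>{..<n} - {i, k}. [:- Q m l, 1:]) = (\<Prod>x\<in>S. [:- x, 1:])"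
      unfolding S_def using inj by (auto simp: prod.reindex P_def Q_def intro!: prod.cong)
    have polys: "roots_poly n (P m) = [:- y i, 1:] * [:- (b + s), 1:] * (\<Prod>x\<in>S. [:- x, 1:])"
      "roots_poly n (Q m) = [:- (y i + s), 1:] * [:- b, 1:] * (\<Prod>x\<in>S. [:- x, 1:])"
      unfolding roots_poly_split2[OF ik] prods using ik(3) by (simp_all add: P_def Q_def Gik)
    have "G m i \<notin> S" "G m k \<notin> S"
      using G(1)[of m] ik unfolding S_def by (auto dest: inj_onD)
    then have "y i \<notin> S" "b \<notin> S"
      unfolding Gik .
    have "finite S"
      by (simp add: S_def)
    obtain Y Z where YZ: "hp_op c (roots_poly n (P m)) = roots_poly (Suc (Suc (card S))) Y"
      "hp_op c (roots_poly n (Q m)) = roots_poly (Suc (Suc (card S))) Z"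
      "\<And>f. convex_on UNIV f \<Longrightarrow> (\<Sum>i\<le>Suc (card S). f (Z i)) \<le> (\<Sum>i\<le>Suc (card S). f (Y i))"
      unfolding polys
      using pinch_simple_roots[OF \<open>c \<noteq> 0\<close> \<open>finite S\<close> \<open>y i \<notin> S\<close> \<open>b \<notin> S\<close> \<open>y i < b\<close> \<open>0 < s\<close>] by blast
    have "{..<n} = {..Suc (card S)}"
      using n by (simp add: lessThan_Suc_atMost)
    then show ?thesis
      using YZ(1,2) YZ(3)[OF assms(2)] n by auto
  qed
  then obtain Y Z where YZ: "\<And>m. hp_op c (roots_poly n (P m)) = roots_poly n (Y m)"
    "\<And>m. hp_op c (roots_poly n (Q m)) = roots_poly n (Z m)"
    "\<And>m. (\<Sum>i<n. f (Z m i)) \<le> (\<Sum>i<n. f (Y m i))"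
    by metis
  have P_lim: "(\<lambda>m. P m l) \<longlonglongrightarrow> y l" for l
    using G(3)[of l] by (cases "l = k") (auto simp: P_def g_def b_def)
  have Q_lim: "(\<lambda>m. Q m l) \<longlonglongrightarrow> (y(i := y i + s, k := y k - s)) l" for l
    using G(3)[of l] ik(3) by (cases "l = i") (auto simp: Q_def g_def b_def)
  have "(\<lambda>m. coeff (roots_poly n (Y m)) j) \<longlonglongrightarrow> coeff (hp_op c (roots_poly n y)) j" for j
    unfolding YZ(1)[symmetric] by (intro tendsto_coeff_hp_op tendsto_coeff_roots_poly P_lim)
  then obtain r y' where r: "strict_mono (r :: nat \<Rightarrow> nat)" "\<And>i. i < n \<Longrightarrow> (\<lambda>m. Y (r m) i) \<longlonglongrightarrow> y' i"
    "hp_op c (roots_poly n y) = roots_poly n y'"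
    using roots_poly_limit[of n Y] by blast
  have "(\<lambda>m. coeff (roots_poly n (Z m)) j)
      \<longlonglongrightarrow> coeff (hp_op c (roots_poly n (y(i := y i + s, k := y k - s)))) j" for j
    unfolding YZ(2)[symmetric] by (intro tendsto_coeff_hp_op tendsto_coeff_roots_poly Q_lim)
  \<comment> \<open>The second subsequence is drawn from the first, so that both families of zeros
    converge along it.\<close>
  from LIMSEQ_subseq_LIMSEQ[OF this r(1)]
  obtain r' z' where r': "strict_mono (r' :: nat \<Rightarrow> nat)" "\<And>i. i < n \<Longrightarrow> (\<lambda>m. Z (r (r' m)) i) \<longlonglongrightarrow> z' i"
    "hp_op c (roots_poly n (y(i := y i + s, k := y k - s))) = roots_poly n z'"
    using roots_poly_limit[of n "\<lambda>m. Z (r m)"] unfolding comp_def by blast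
  \<comment> \<open>A convex function on the whole real line is continuous, so the inequality passes
    to the limit.\<close>
  have cont: "isCont f x" for x
    using convex_on_continuous[OF open_UNIV assms(2)] by (simp add: continuous_on_eq_continuous_at)
  have "(\<lambda>m. \<Sum>i<n. f (Z (r (r' m)) i)) \<longlonglongrightarrow> (\<Sum>i<n. f (z' i))"
    using r'(2) by (intro tendsto_sum isCont_tendsto_compose[OF cont]) auto
  moreover have "(\<lambda>m. \<Sum>i<n. f (Y (r (r' m)) i)) \<longlonglongrightarrow> (\<Sum>i<n. f (y' i))"
    using LIMSEQ_subseq_LIMSEQ[OF r(2) r'(1)] unfolding comp_def
    by (intro tendsto_sum isCont_tendsto_compose[OF cont]) auto
  ultimately have "(\<Sum>i<n. f (z' i)) \<le> (\<Sum>i<n. f (y' i))"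
    by (rule LIMSEQ_le) (use YZ(3) in auto)
  then show ?thesis
    by (simp add: r(3) r'(3) sum_proots_roots_poly)
qed

section \<open>Majorization\<close>

text \<open>The bound on tail sums makes it unnecessary to keep \<open>y\<close> sorted during the induction.\<close>
lemma pinch_induct:
  fixes F :: "(nat \<Rightarrow> real) \<Rightarrow> real"
  assumes cong: "\<And>x y. (\<And>i. i < n \<Longrightarrow> x i = y i) \<Longrightarrow> F x = F y"
    and pinch: "\<And>y i k s. i < n \<Longrightarrow> k < n \<Longrightarrow> i \<noteq> k \<Longrightarrow> 0 \<le> s \<Longrightarrow> s \<le> y k - y i \<Longrightarrow>
      F (y(i := y i + s, k := y k - s)) \<le> F y"
    and sorted: "\<And>i j. i \<le> j \<Longrightarrow> j < n \<Longrightarrow> x i \<le> x j"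
    and tails: "\<And>m. m \<le> n \<Longrightarrow> sum x {m..<n} \<le> sum y {m..<n}"
    and total: "sum x {..<n} = sum y {..<n}"
  shows "F x \<le> F y"
  using tails total
proof (induction "card {i. i < n \<and> x i \<noteq> y i}" arbitrary: y rule: less_induct)
  case less
  show ?case
  proof (cases "\<forall>i<n. x i = y i")
    case True
    then show ?thesis
      using cong[of x y] by simp
  next
    case False
    have "\<exists>k<n. x k < y k"
    proof (rule ccontr)
      assume "\<not> (\<exists>k<n. x k < y k)"
      then have le: "\<forall>k\<in>{..<n}. y k \<le> x k"
        by force
      moreover have "\<exists>k\<in>{..<n}. y k < x k"
        using False le by force
      ultimately have "sum y {..<n} < sum x {..<n}"
        by (intro sum_strict_mono_ex1) auto
      then show False
        using less.prems(2) by simp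
    qed
    \<comment> \<open>\<open>k\<close> is the first index at which \<open>y\<close> is too large,
      and \<open>i\<close> will be the last index before \<open>k\<close> at which it is too small;
      between them \<open>x\<close> and \<open>y\<close> agree.\<close>
    define k where "k = (LEAST k. k < n \<and> x k < y k)"
    have k: "k < n" "x k < y k"
      using LeastI_ex[of "\<lambda>k. k < n \<and> x k < y k"] \<open>\<exists>k<n. x k < y k\<close> unfolding k_def by auto
    have before_k: "y l \<le> x l" if "l < k" for l
      using not_less_Least[of l "\<lambda>k. k < n \<and> x k < y k"] that k(1) unfolding k_def by force
    have k_split: "sum g {m..<n} = sum g {m..<k} + g k + sum g {Suc k..<n}" if "m \<le> k" for g :: "nat \<Rightarrow> real" and m
    proof -
      have "sum g {m..<n} = sum g {m..<k} + sum g {k..<n}"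
        using that k(1) by (simp add: sum.atLeastLessThan_concat)
      then show ?thesis
        using k(1) by (simp add: sum.atLeast_Suc_lessThan)
    qed
    have tail_k: "sum x {Suc k..<n} \<le> sum y {Suc k..<n}"
      using less.prems(1)[of "Suc k"] k(1) by simp
    \<comment> \<open>Otherwise the part before \<open>k\<close>, the strict gap at \<open>k\<close>
      and the tail after \<open>k\<close> would together make the total of \<open>y\<close> too
      large.\<close>
    have "\<exists>i<k. y i < x i"
    proof (rule ccontr)
      assume "\<not> (\<exists>i<k. y i < x i)"
      then have "sum x {..<k} \<le> sum y {..<k}"
        by (intro sum_mono) (use not_less in auto)
      then show False
        using less.prems(2) k_split[of 0 x] k_split[of 0 y] tail_k k(2) by (simp add: atLeast0LessThan)
    qed
    define i where "i = (GREATEST i. i < k \<and> y i < x i)"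
    have i: "i < k" "y i < x i"
      using GreatestI_ex_nat[of "\<lambda>i. i < k \<and> y i < x i" k] \<open>\<exists>i<k. y i < x i\<close> unfolding i_def by auto
    have between: "y l = x l" if "i < l" "l < k" for l
    proof -
      have "\<not> y l < x l"
        using Greatest_le_nat[of "\<lambda>i. i < k \<and> y i < x i" l k] that unfolding i_def by auto
      then show ?thesis
        using before_k[OF that(2)] by simp
    qed
    \<comment> \<open>The largest transfer for which neither coordinate passes its target; one of
      them reaches it, so the number of disagreements drops.\<close>
    define s where "s = min (x i - y i) (y k - x k)"
    define y' where "y' = y(i := y i + s, k := y k - s)"
    have s: "0 < s" "y i + s \<le> x i" "x k \<le> y k - s"
      using i k by (auto simp: s_def)
    have "i < n" "i \<noteq> k"
      using i k by auto
    \<comment> \<open>Sortedness of \<open>x\<close> enters here: y i + s \<le> x i \<le> x k \<le>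
      y k - s, so the transfer is an admissible pinch.\<close>
    have "x i \<le> x k"
      using sorted[of i k] i k by simp
    have tail_between: "sum y {m..<k} = sum x {m..<k}" if "i < m" for m
      using between that by (intro sum.cong) auto
    have "F x \<le> F y'"
    proof (rule less.hyps)
      have "x i = y' i \<or> x k = y' k"
        using \<open>i \<noteq> k\<close> by (auto simp: y'_def s_def min_def)
      moreover have "x l \<noteq> y l" if "x l \<noteq> y' l" for l
        using that i k by (auto simp: y'_def split: if_splits)
      ultimately have "{l. l < n \<and> x l \<noteq> y' l} \<subset> {l. l < n \<and> x l \<noteq> y l}"
        using i k \<open>i < n\<close> by auto
      then show "card {l. l < n \<and> x l \<noteq> y' l} < card {l. l < n \<and> x l \<noteq> y l}"
        by (intro psubset_card_mono) auto
      have y'_sum: "sum y' A = sum y A + (if i \<in> A then s else 0) - (if k \<in> A then s else 0)"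
        if "finite A" for A
      proof -
        have "sum y' A = (\<Sum>l\<in>A. y l + (if l = i then s else 0) - (if l = k then s else 0))"
          using \<open>i \<noteq> k\<close> by (intro sum.cong) (auto simp: y'_def)
        then show ?thesis
          using that by (simp add: sum.distrib sum_subtractf)
      qed
      show "sum x {..<n} = sum y' {..<n}"
        using less.prems(2) \<open>i < n\<close> k(1) by (simp add: y'_sum)
      show "sum x {m..<n} \<le> sum y' {m..<n}" if "m \<le> n" for m
      \<comment> \<open>Only tails that start after \<open>i\<close> and no later than
        \<open>k\<close> lose \<open>s\<close>. In these, \<open>y'\<close> agrees with
        \<open>x\<close> before \<open>k\<close>, is at least \<open>x k\<close> at
        \<open>k\<close>, and keeps the tail of \<open>y\<close> after \<open>k\<close>.\<close>
      proof (cases "i < m \<and> m \<le> k")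
        case True
        then show ?thesis
          using k_split[of m x] k_split[of m y] tail_between[of m] tail_k s(3) k(1) by (simp add: y'_sum)
      next
        case False
        then show ?thesis
          using less.prems(1)[OF that] \<open>i < n\<close> i k(1) by (auto simp: y'_sum)
      qed
    qed
    also have "F y' \<le> F y"
      unfolding y'_def using s i k \<open>i < n\<close> \<open>i \<noteq> k\<close> \<open>x i \<le> x k\<close> by (intro pinch) auto
    finally show ?thesis .
  qed
qed

text \<open>As test functions, the identity and its negative give equal totals, and a hinge gives
  the tail inequality.\<close>

lemma majorized_tails:
  fixes n m :: nat
  assumes maj: "image_mset x (mset_set {..<n}) \<prec>\<^sub>m image_mset y (mset_set {..<n})"
    and y_sorted: "\<And>i j. i \<le> j \<Longrightarrow> j < n \<Longrightarrow> y i \<le> y j"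
  shows "sum x {..<n} = sum y {..<n}" "m \<le> n \<Longrightarrow> sum x {m..<n} \<le> sum y {m..<n}"
proof -
  have conv: "(\<Sum>i<n. f (x i)) \<le> (\<Sum>i<n. f (y i))" if "convex_on UNIV f" for f :: "real \<Rightarrow> real"
    using maj that by (auto simp: majorized_def image_mset.compositionality comp_def sum_unfold_sum_mset)
  have affine: "convex_on UNIV (\<lambda>v::real. a * v + b)" for a b
    by (rule convex_on_realI[where f' = "\<lambda>_. a"]) (auto intro!: derivative_eq_intros)
  have "sum x {..<n} \<le> sum y {..<n}"
    using conv[OF affine[of 1 0]] by simp
  moreover have "sum y {..<n} \<le> sum x {..<n}"
    using conv[OF affine[of "-1" 0]] by (simp add: sum_negf)
  ultimately show total: "sum x {..<n} = sum y {..<n}"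
    by simp
  show "sum x {m..<n} \<le> sum y {m..<n}" if "m \<le> n"
  proof (cases "m = n")
    case False
    with \<open>m \<le> n\<close> have "m < n"
      by simp
    \<comment> \<open>The corner is at \<open>y m\<close>: since \<open>y\<close> is sorted, the
      hinge sum over \<open>y\<close> is exactly the tail sum of \<open>y i - y m\<close>, while
      over \<open>x\<close> it is at least the tail sum of \<open>x i - y m\<close>.\<close>
    define h where "h = (\<lambda>v. max 0 (v - y m))"
    have "convex_on UNIV h"
    proof (rule convex_onI)
      fix t a b :: real
      assume "0 < t" "t < 1"
      then have "(1 - t) * (a - y m) \<le> (1 - t) * max 0 (a - y m)" "t * (b - y m) \<le> t * max 0 (b - y m)"
        "0 \<le> (1 - t) * max 0 (a - y m)" "0 \<le> t * max 0 (b - y m)"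
        by (auto intro!: mult_left_mono mult_nonneg_nonneg)
      moreover have "(1 - t) * a + t * b - y m = (1 - t) * (a - y m) + t * (b - y m)"
        by (simp add: algebra_simps)
      ultimately show "h ((1 - t) *\<^sub>R a + t *\<^sub>R b) \<le> (1 - t) * h a + t * h b"
        unfolding h_def real_scaleR_def by (intro max.boundedI) linarith+
    qed simp
    have split: "sum g {..<n} = sum g {..<m} + sum g {m..<n}" for g :: "nat \<Rightarrow> real"
      using \<open>m < n\<close> by (metis atLeast0LessThan le0 less_imp_le sum.atLeastLessThan_concat)
    have "sum (\<lambda>i. x i - y m) {m..<n} \<le> (\<Sum>i=m..<n. h (x i))"
      by (intro sum_mono) (simp add: h_def)
    also have "\<dots> \<le> (\<Sum>i<n. h (x i))"
      unfolding split[of "\<lambda>i. h (x i)"] by (simp add: sum_nonneg h_def)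
    also have "\<dots> \<le> (\<Sum>i<n. h (y i))"
      using conv[OF \<open>convex_on UNIV h\<close>] .
    also have "\<dots> = (\<Sum>i=m..<n. h (y i))"
      unfolding split[of "\<lambda>i. h (y i)"] using y_sorted \<open>m < n\<close> by (auto simp: h_def intro!: sum.neutral)
    also have "\<dots> = sum (\<lambda>i. y i - y m) {m..<n}"
      using y_sorted by (intro sum.cong) (auto simp: h_def)
    finally show ?thesis
      by (simp add: sum_subtractf)
  qed simp
qed

section \<open>Hyperbolic polynomials\<close>

lemma map_poly_of_real_mult:
  "map_poly complex_of_real (p * q) = map_poly complex_of_real p * map_poly complex_of_real q"
  by (rule poly_eqI) (simp add: coeff_map_poly coeff_mult)

lemma poly_map_poly_of_real:
  "poly (map_poly complex_of_real p) (complex_of_real x) = complex_of_real (poly p x)"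
  by (induction p) (simp_all add: map_poly_pCons)

lemma roots_poly_hyperbolic: "roots_poly n y \<in> hyperbolic_polys n"
proof -
  have "z \<in> \<real>" if "poly (map_poly complex_of_real (roots_poly n y)) z = 0" for z
    using that
  proof (induction n)
    case (Suc n)
    then show ?case
      unfolding roots_poly_Suc map_poly_of_real_mult by (auto simp: map_poly_pCons)
  qed (simp add: roots_poly_def)
  then show ?thesis
    by (simp add: hyperbolic_polys_def)
qed

text \<open>The fundamental theorem of algebra gives a complex zero, which is real by hyperbolicity;
  its linear factor is split off and the degree drops.\<close>

lemma hyperbolic_eq_roots_poly:
  assumes "p \<in> hyperbolic_polys n"
  shows "\<exists>y. p = roots_poly n y"
  using assms
proof (induction n arbitrary: p)
  case 0
  then have "degree p = 0" "lead_coeff p = 1"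
    by (auto simp: hyperbolic_polys_def)
  then have "p = 1"
    by (metis degree_eq_zeroE lead_coeff_pCons(2) one_pCons)
  then show ?case
    by (simp add: roots_poly_def)
next
  case (Suc n)
  then have p: "degree p = Suc n" "lead_coeff p = 1"
    "\<And>z. poly (map_poly complex_of_real p) z = 0 \<Longrightarrow> z \<in> \<real>"
    by (auto simp: hyperbolic_polys_def)
  have "degree (map_poly complex_of_real p) = Suc n"
    using p(1) by (subst degree_map_poly) auto
  then obtain z where z: "poly (map_poly complex_of_real p) z = 0"
    using fundamental_theorem_of_algebra constant_degree by (metis nat.distinct(1))
  with p(3) obtain x where "z = complex_of_real x"
    by (meson Reals_cases)
  with z have "poly p x = 0"
    by (simp add: poly_map_poly_of_real)
  then obtain q where q: "p = [:- x, 1:] * q"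
    by (meson poly_eq_0_iff_dvd dvdE)
  have "q \<noteq> 0"
    using p(1) q by auto
  then have "degree q = n"
    using p(1) unfolding q by (subst (asm) degree_mult_eq) auto
  moreover have "lead_coeff q = 1"
    using p(2) unfolding q lead_coeff_mult by simp
  moreover have "w \<in> \<real>" if "poly (map_poly complex_of_real q) w = 0" for w
    using p(3)[of w] that by (simp add: q map_poly_of_real_mult del: mult_pCons_left)
  ultimately have "q \<in> hyperbolic_polys n"
    by (simp add: hyperbolic_polys_def)
  then obtain y where y: "q = roots_poly n y"
    using Suc.IH by blast
  have "p = roots_poly (Suc n) (y(n := x))"
    unfolding roots_poly_Suc q y using roots_poly_cong[of n y "y(n := x)"] by simp
  then show ?case
    by blast
qed

text \<open>Sorting only permutes the factors. Sorted families are what \<open>pinch_induct\<close>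
  and \<open>majorized_tails\<close> ask for.\<close>

lemma hyperbolic_eq_sorted_roots_poly:
  assumes "p \<in> hyperbolic_polys n"
  obtains y where "p = roots_poly n y" "\<And>i j. i \<le> j \<Longrightarrow> j < n \<Longrightarrow> y i \<le> y j"
proof -
  obtain w where w: "p = roots_poly n w"
    using hyperbolic_eq_roots_poly[OF assms] by blast
  define ws where "ws = map w [0..<n]"
  have len: "length ws = n" "length (sort ws) = n"
    by (simp_all add: ws_def)
  have "roots_poly n ((!) vs) = prod_mset (image_mset (\<lambda>x. [:- x, 1:]) (mset vs))" if "length vs = n" for vs
  proof -
    have "prod_mset (image_mset (\<lambda>x. [:- x, 1:]) (mset vs)) = prod_list (map (\<lambda>x. [:- x, 1:]) vs)"
      by (simp flip: mset_map prod_mset_prod_list)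
    then show ?thesis
      using that by (simp add: roots_poly_def prod.list_conv_set_nth atLeast0LessThan)
  qed
  then have "roots_poly n ((!) (sort ws)) = roots_poly n ((!) ws)"
    using len by simp
  also have "\<dots> = p"
    unfolding w by (intro roots_poly_cong) (simp add: ws_def)
  finally show thesis
    using that[of "(!) (sort ws)"] len sorted_nth_mono[of "sort ws"] by auto
qed

section \<open>Preservation of the spectral order\<close>

theorem theorem2:
  fixes n :: nat and P Q :: "real poly"
  assumes "n \<ge> 1"
    and "P \<in> hyperbolic_polys n" and "Q \<in> hyperbolic_polys n"
    and "spectral_le n Q P"
  shows "\<forall>c::real. spectral_le n (Q - smult c (pderiv Q)) (P - smult c (pderiv P))"
proof
  fix c :: real
  show "spectral_le n (Q - smult c (pderiv Q)) (P - smult c (pderiv P))"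
  proof (cases "c = 0")
    case True
    then show ?thesis
      using assms(4) by simp
  next
    case False
    obtain x where x: "Q = roots_poly n x" "\<And>i j. i \<le> j \<Longrightarrow> j < n \<Longrightarrow> x i \<le> x j"
      using hyperbolic_eq_sorted_roots_poly[OF assms(3)] by blast
    obtain y where y: "P = roots_poly n y" "\<And>i j. i \<le> j \<Longrightarrow> j < n \<Longrightarrow> y i \<le> y j"
      using hyperbolic_eq_sorted_roots_poly[OF assms(2)] by blast
    have maj: "image_mset x (mset_set {..<n}) \<prec>\<^sub>m image_mset y (mset_set {..<n})"
      using assms(4) by (simp add: spectral_le_def x(1) y(1) proots_roots_poly)
    \<comment> \<open>Real-rootedness of both images gives the two multisets of zeros the same size,
      as majorization requires.\<close>
    obtain x' y' where TQ: "hp_op c Q = roots_poly n x'" and TP: "hp_op c P = roots_poly n y'"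
      using hp_op_real_rooted[of c n] x(1) y(1) by metis
    have "(\<Sum>v\<in>#proots (hp_op c Q). f v) \<le> (\<Sum>v\<in>#proots (hp_op c P). f v)"
      if "convex_on UNIV f" for f
      unfolding x(1) y(1)
    \<comment> \<open>\<open>F\<close> takes a family of zeros to the sum of \<open>f\<close> over
      the zeros of the image polynomial; by \<open>hp_op_pinch\<close> no pinch increases
      it.\<close>
    proof (rule pinch_induct[where F = "\<lambda>y. \<Sum>v\<in>#proots (hp_op c (roots_poly n y)). f v"])
      show "(\<Sum>v\<in>#proots (hp_op c (roots_poly n z)). f v) = (\<Sum>v\<in>#proots (hp_op c (roots_poly n w)). f v)"
        if "\<And>i. i < n \<Longrightarrow> z i = w i" for z w
        using roots_poly_cong[of n z w] that by simp
    qed (use hp_op_pinch[OF False that] x(2) majorized_tails[OF maj y(2)] in auto)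
    then have "proots (hp_op c Q) \<prec>\<^sub>m proots (hp_op c P)"
      by (simp add: majorized_def TQ TP proots_roots_poly)
    then have "spectral_le n (hp_op c Q) (hp_op c P)"
      by (simp add: spectral_le_def TQ TP roots_poly_hyperbolic)
    then show ?thesis
      by (simp add: hp_op_def)
  qed
qed

end
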